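(* Let $A:\mathbb S\to Set$ be a functor. The functor $\hat A:Set\to Set$ weakly preserves pullbacks if and only if $A$ satisfies the following condition (WPB): for any pullback square of surjections in $\mathbb F$ $$f_1\circ g_2=g_1\circ f_2,\qquad g_2:(p]\to(m],\quad f_2:(p]\to(n],\quad f_1:(m]\to(k],\quad g_1:(n]\to(k],$$ and any pair of elements $a\in A((m])$, $b\in A((n])$ such that $A(f_1)(a)=A(g_1)(b)$, there are an injection $h:(q]\to(p]$ and an element $c\in A((q])$ such that $f_2\circ h$ and $g_2\circ h$ are surjections and $$A(g_2\circ h)(c)=a\quad\text{and}\quad A(f_2\circ h)(c)=b.$$
   Context: Notation: $(n]=\{1,\dots,n\}$ for $n\in\omega=\{0,1,2,\dots\}$. $\mathbb F$ is the category with objects $(n]$, $n\in\omega$, and all functions as morphisms; $\mathbb S$ is its subcategory with the same objects and surjections. For a set $X$, $\left[{X\atop n}\right]$ is the set of injections $(n]\to X$, on which $S_n$ acts on the right by composition. For $A:\mathbb S\to Set$ write $A_n=A((n])$ and let $\left[{X\atop n}\right]\otimes_n A_n$ be the quotient of $\left[{X\atop n}\right]\times A_n$ by $(\vec x\circ\sigma,a)\sim(\vec x,A(\sigma)(a))$, $\sigma\in S_n$; classes are written $[\vec x,a]$. Put $\hat A(X)=\sum_{n\in\omega}\left[{X\atop n}\right]\otimes_nA_n$. For $f:X\to Y$, $\hat A(f)([\vec x,a])=[\vec y,A(\alpha)(a)]$, where $f\circ\vec x=\vec y\circ\alpha$ with $\alpha:(n]\to(m]$ surjective and $\vec y:(m]\to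 Y$ injective. (This is the left Kan extension of $A$ along the inclusion $\mathbb S\to Set$.) A functor weakly preserves pullbacks if it sends pullback squares to weak pullback squares (the universal property with existence but not necessarily uniqueness). *)

theory Defs
  imports "HOL-Library.FuncSet"
begin

section \<open>Categories, functors and pullbacks\<close>

text \<open>
  Arrows are untyped: an element of \<^typ>\<open>'f\<close> may belong to several hom-sets.  Hence composition
  gets the source object \<open>X\<close> of the first arrow, \<open>Cmp C X g f\<close> being \<open>g \<circ> f\<close> for
  \<open>f : X \<rightarrow> Y\<close> and \<open>g : Y \<rightarrow> Z\<close>, and the arrow part of a functor gets source and target.
\<close>

record ('o, 'f) category =
  Obj :: "'o set"
  Hom :: "'o \<Rightarrow> 'o \<Rightarrow> 'f set"
  Idn :: "'o \<Rightarrow> 'f"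
  Cmp :: "'o \<Rightarrow> 'f \<Rightarrow> 'f \<Rightarrow> 'f"

record ('o, 'f, 'p, 'g) cfunctor =
  fobj :: "'o \<Rightarrow> 'p"
  fmap :: "'o \<Rightarrow> 'o \<Rightarrow> 'f \<Rightarrow> 'g"

definition is_category :: "('o, 'f) category \<Rightarrow> bool" where
  "is_category C \<longleftrightarrow>
     (\<forall>X\<in>Obj C. Idn C X \<in> Hom C X X) \<and>
     (\<forall>X\<in>Obj C. \<forall>Y\<in>Obj C. \<forall>Z\<in>Obj C. \<forall>f\<in>Hom C X Y. \<forall>g\<in>Hom C Y Z.
        Cmp C X g f \<in> Hom C X Z) \<and>
     (\<forall>X\<in>Obj C. \<forall>Y\<in>Obj C. \<forall>f\<in>Hom C X Y.
        Cmp C X f (Idn C X) = f \<and> Cmp C X (Idn C Y) f = f) \<and>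
     (\<forall>W\<in>Obj C. \<forall>X\<in>Obj C. \<forall>Y\<in>Obj C. \<forall>Z\<in>Obj C.
        \<forall>f\<in>Hom C W X. \<forall>g\<in>Hom C X Y. \<forall>h\<in>Hom C Y Z.
        Cmp C W h (Cmp C W g f) = Cmp C W (Cmp C X h g) f)"

definition is_functor ::
  "('o, 'f) category \<Rightarrow> ('p, 'g) category \<Rightarrow> ('o, 'f, 'p, 'g) cfunctor \<Rightarrow> bool" where
  "is_functor C D F \<longleftrightarrow>
     (\<forall>X\<in>Obj C. fobj F X \<in> Obj D) \<and>
     (\<forall>X\<in>Obj C. \<forall>Y\<in>Obj C. \<forall>f\<in>Hom C X Y. fmap F X Y f \<in> Hom D (fobj F X) (fobj F Y)) \<and>
     (\<forall>X\<in>Obj C. fmap F X X (Idn C X) = Idn D (fobj F X)) \<and>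
     (\<forall>X\<in>Obj C. \<forall>Y\<in>Obj C. \<forall>Z\<in>Obj C. \<forall>f\<in>Hom C X Y. \<forall>g\<in>Hom C Y Z.
        fmap F X Z (Cmp C X g f) = Cmp D (fobj F X) (fmap F Y Z g) (fmap F X Y f))"

text \<open>
  The squares below have corner \<open>P\<close>, projections \<open>p : P \<rightarrow> X\<close> and \<open>q : P \<rightarrow> Y\<close>, and
  sides \<open>f : X \<rightarrow> Z\<close> and \<open>g : Y \<rightarrow> Z\<close>.
\<close>

definition is_commuting_square ::
  "('o, 'f) category \<Rightarrow> 'o \<Rightarrow> 'o \<Rightarrow> 'o \<Rightarrow> 'o \<Rightarrow> 'f \<Rightarrow> 'f \<Rightarrow> 'f \<Rightarrow> 'f \<Rightarrow> bool" where
  "is_commuting_square C P X Y Z p q f g \<longleftrightarrow>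
     {P, X, Y, Z} \<subseteq> Obj C \<and>
     p \<in> Hom C P X \<and> q \<in> Hom C P Y \<and> f \<in> Hom C X Z \<and> g \<in> Hom C Y Z \<and>
     Cmp C P f p = Cmp C P g q"

definition is_pullback ::
  "('o, 'f) category \<Rightarrow> 'o \<Rightarrow> 'o \<Rightarrow> 'o \<Rightarrow> 'o \<Rightarrow> 'f \<Rightarrow> 'f \<Rightarrow> 'f \<Rightarrow> 'f \<Rightarrow> bool" where
  "is_pullback C P X Y Z p q f g \<longleftrightarrow>
     is_commuting_square C P X Y Z p q f g \<and>
     (\<forall>W\<in>Obj C. \<forall>u\<in>Hom C W X. \<forall>v\<in>Hom C W Y. Cmp C W f u = Cmp C W g v \<longrightarrow>
        (\<exists>!w. w \<in> Hom C W P \<and> Cmp C W p w = u \<and> Cmp C W q w = v))"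

definition is_weak_pullback ::
  "('o, 'f) category \<Rightarrow> 'o \<Rightarrow> 'o \<Rightarrow> 'o \<Rightarrow> 'o \<Rightarrow> 'f \<Rightarrow> 'f \<Rightarrow> 'f \<Rightarrow> 'f \<Rightarrow> bool" where
  "is_weak_pullback C P X Y Z p q f g \<longleftrightarrow>
     is_commuting_square C P X Y Z p q f g \<and>
     (\<forall>W\<in>Obj C. \<forall>u\<in>Hom C W X. \<forall>v\<in>Hom C W Y. Cmp C W f u = Cmp C W g v \<longrightarrow>
        (\<exists>w. w \<in> Hom C W P \<and> Cmp C W p w = u \<and> Cmp C W q w = v))"

definition weakly_preserves_pullbacks ::
  "('o, 'f) category \<Rightarrow> ('p, 'g) category \<Rightarrow> ('o, 'f, 'p, 'g) cfunctor \<Rightarrow> bool" where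
  "weakly_preserves_pullbacks C D F \<longleftrightarrow>
     (\<forall>P X Y Z p q f g. is_pullback C P X Y Z p q f g \<longrightarrow>
        is_weak_pullback D (fobj F P) (fobj F X) (fobj F Y) (fobj F Z)
          (fmap F P X p) (fmap F P Y q) (fmap F X Z f) (fmap F Y Z g))"


section \<open>The categories of sets, of finite ordinals, and of surjections\<close>

text \<open>
  Morphisms are extensional functions (\<^const>\<open>undefined\<close> outside their domain), so that equality
  of morphisms is equality in HOL.  \<open>set_cat\<close> is the category of all sets with elements in the
  type \<^typ>\<open>'u\<close>, which plays the role of the universe.
\<close>

definition set_cat :: "('u set, 'u \<Rightarrow> 'u) category" where
  "set_cat = \<lparr> Obj = UNIV, Hom = (\<lambda>X Y. X \<rightarrow>\<^sub>E Y), Idn = (\<lambda>X. \<lambda>x\<in>X. x), Cmp = compose \<rparr>"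

text \<open>The object \<open>n\<close> of \<open>fin_cat\<close> stands for \<open>{1..n}\<close>.\<close>

definition fin_cat :: "(nat, nat \<Rightarrow> nat) category" where
  "fin_cat = \<lparr> Obj = UNIV, Hom = (\<lambda>n m. {1..n} \<rightarrow>\<^sub>E {1..m}),
               Idn = (\<lambda>n. \<lambda>i\<in>{1..n}. i), Cmp = (\<lambda>n. compose {1..n}) \<rparr>"

definition surj_cat :: "(nat, nat \<Rightarrow> nat) category" where
  "surj_cat = fin_cat \<lparr> Hom := (\<lambda>n m. {f \<in> {1..n} \<rightarrow>\<^sub>E {1..m}. f ` {1..n} = {1..m}}) \<rparr>"

lemma is_category_set_cat: "is_category set_cat"
  unfolding is_category_def set_cat_def
  by (auto simp: compose_def PiE_iff extensional_def fun_eq_iff restrict_def)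

lemma is_category_fin_cat: "is_category fin_cat"
  unfolding is_category_def fin_cat_def
  by (auto simp: compose_def PiE_iff extensional_def fun_eq_iff restrict_def)

lemma is_category_surj_cat: "is_category surj_cat"
proof -
  have "f \<in> {1..n} \<rightarrow> {1..m} \<and> f \<in> extensional {1..n} \<and> f ` {1..n} = {1..m}"
    if "f \<in> Hom surj_cat n m" for f n m
    using that by (auto simp: surj_cat_def fin_cat_def PiE_iff)
  note D = this[THEN conjunct1] this[THEN conjunct2, THEN conjunct1]
    this[THEN conjunct2, THEN conjunct2]
  have I: "f \<in> Hom surj_cat n m" if "f ` {1..n} = {1..m}" "f \<in> extensional {1..n}" for f n m
    using that by (auto simp: surj_cat_def fin_cat_def PiE_iff)
  have E: "Obj surj_cat = UNIV" "Idn surj_cat = (\<lambda>n. \<lambda>i\<in>{1..n}. i)"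
    "Cmp surj_cat = (\<lambda>n. compose {1..n})"
    by (simp_all add: surj_cat_def fin_cat_def)
  show ?thesis
    unfolding is_category_def E
  proof (intro conjI ballI)
    fix n m k f g assume f: "f \<in> Hom surj_cat n m" and g: "g \<in> Hom surj_cat m k"
    show "compose {1..n} g f \<in> Hom surj_cat n k"
      by (rule I[OF surj_compose[OF D(3)[OF f] D(3)[OF g]] compose_extensional])
  next
    fix n m f assume f: "f \<in> Hom surj_cat n m"
    show "compose {1..n} f (\<lambda>i\<in>{1..n}. i) = f" by (rule compose_Id[OF D(1,2)[OF f]])
    show "compose {1..n} (\<lambda>i\<in>{1..m}. i) f = f" by (rule Id_compose[OF D(1,2)[OF f]])
  next
    fix n m k l f g h assume f: "f \<in> Hom surj_cat n m"
    show "compose {1..n} h (compose {1..n} g f) = compose {1..n} (compose {1..m} h g) f"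
      by (rule compose_assoc[OF D(1)[OF f]])
  qed (auto intro: I)
qed


section \<open>The left Kan extension of a functor on surjections\<close>

type_synonym 'a surj_functor = "(nat, nat \<Rightarrow> nat, 'a set, 'a \<Rightarrow> 'a) cfunctor"

definition injs :: "nat \<Rightarrow> 'u set \<Rightarrow> (nat \<Rightarrow> 'u) set" where
  "injs n X = {x \<in> {1..n} \<rightarrow>\<^sub>E X. inj_on x {1..n}}"

definition perms :: "nat \<Rightarrow> (nat \<Rightarrow> nat) set" where
  "perms n = {\<sigma> \<in> {1..n} \<rightarrow>\<^sub>E {1..n}. bij_betw \<sigma> {1..n} {1..n}}"

definition tensor_rel ::
  "'a surj_functor \<Rightarrow> nat \<Rightarrow> 'u set \<Rightarrow> (((nat \<Rightarrow> 'u) \<times> 'a) \<times> ((nat \<Rightarrow> 'u) \<times> 'a)) set" where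
  "tensor_rel A n X =
     {((compose {1..n} x \<sigma>, a), (x, fmap A n n \<sigma> a)) | x \<sigma> a.
        x \<in> injs n X \<and> \<sigma> \<in> perms n \<and> a \<in> fobj A n}"

type_synonym ('u, 'a) hat_elem = "nat \<times> ((nat \<Rightarrow> 'u) \<times> 'a) set"

text \<open>
  The class \<open>[x, a]\<close>, tagged with the index \<open>n\<close> of its summand.
\<close>

definition hat_class ::
  "'a surj_functor \<Rightarrow> 'u set \<Rightarrow> nat \<Rightarrow> (nat \<Rightarrow> 'u) \<Rightarrow> 'a \<Rightarrow> ('u, 'a) hat_elem" where
  "hat_class A X n x a = (n, tensor_rel A n X `` {(x, a)})"

definition hat_obj :: "'a surj_functor \<Rightarrow> 'u set \<Rightarrow> ('u, 'a) hat_elem set" where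
  "hat_obj A X = (SIGMA n:UNIV. (injs n X \<times> fobj A n) // tensor_rel A n X)"

definition hat_map ::
  "'a surj_functor \<Rightarrow> 'u set \<Rightarrow> 'u set \<Rightarrow> ('u \<Rightarrow> 'u) \<Rightarrow> ('u, 'a) hat_elem \<Rightarrow> ('u, 'a) hat_elem" where
  "hat_map A X Y f = (\<lambda>t\<in>hat_obj A X. THE s.
     \<exists>n x a m y \<alpha>. x \<in> injs n X \<and> a \<in> fobj A n \<and> t = hat_class A X n x a \<and>
       y \<in> injs m Y \<and> \<alpha> \<in> Hom surj_cat n m \<and>
       compose {1..n} f x = compose {1..n} y \<alpha> \<and>
       s = hat_class A Y m y (fmap A n m \<alpha> a))"

text \<open>
  Simple types force a change of universe: \<open>hat A\<close> maps sets over \<^typ>\<open>'u\<close> to sets over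
  \<^typ>\<open>('u, 'a) hat_elem\<close>.
\<close>

definition hat ::
  "'a surj_functor \<Rightarrow> ('u set, 'u \<Rightarrow> 'u, ('u, 'a) hat_elem set,
     ('u, 'a) hat_elem \<Rightarrow> ('u, 'a) hat_elem) cfunctor" where
  "hat A = \<lparr> fobj = hat_obj A, fmap = hat_map A \<rparr>"


text \<open>\<open>tensor_rel\<close> is an equivalence relation, and \<open>hat A\<close> is a functor.\<close>

lemma surj_homD:
  assumes "f \<in> Hom surj_cat n m"
  shows "f \<in> {1..n} \<rightarrow> {1..m}" "f \<in> extensional {1..n}" "f ` {1..n} = {1..m}"
  using assms by (auto simp: surj_cat_def fin_cat_def PiE_iff)

lemma surj_homI:
  assumes "f ` {1..n} = {1..m}" "f \<in> extensional {1..n}"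
  shows "f \<in> Hom surj_cat n m"
  using assms by (auto simp: surj_cat_def fin_cat_def PiE_iff)

lemma perms_surj_hom: "\<sigma> \<in> perms n \<Longrightarrow> \<sigma> \<in> Hom surj_cat n n"
  by (auto simp: perms_def surj_cat_def fin_cat_def bij_betw_def)

lemma fmap_surj_mem:
  assumes "is_functor surj_cat set_cat A" "f \<in> Hom surj_cat n m" "a \<in> fobj A n"
  shows "fmap A n m f a \<in> fobj A m"
proof -
  have "fmap A n m f \<in> fobj A n \<rightarrow>\<^sub>E fobj A m"
    using assms(1,2) unfolding is_functor_def by (simp add: set_cat_def surj_cat_def fin_cat_def)
  then show ?thesis using assms(3) by blast
qed

lemma fmap_surj_id:
  assumes "is_functor surj_cat set_cat A" "a \<in> fobj A n"
  shows "fmap A n n (\<lambda>i\<in>{1..n}. i) a = a"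
  using assms unfolding is_functor_def by (simp add: set_cat_def surj_cat_def fin_cat_def)

lemma fmap_surj_comp:
  assumes "is_functor surj_cat set_cat A" "f \<in> Hom surj_cat n m" "g \<in> Hom surj_cat m k"
    and "a \<in> fobj A n"
  shows "fmap A n k (compose {1..n} g f) a = fmap A m k g (fmap A n m f a)"
proof -
  have "fmap A n k (compose {1..n} g f) = compose (fobj A n) (fmap A m k g) (fmap A n m f)"
    using assms(1-3) unfolding is_functor_def by (simp add: set_cat_def surj_cat_def fin_cat_def)
  then show ?thesis using assms(4) by (simp add: compose_eq)
qed

lemma surj_hom_comp:
  assumes "f \<in> Hom surj_cat n m" "g \<in> Hom surj_cat m k"
  shows "compose {1..n} g f \<in> Hom surj_cat n k"
  using surj_compose[OF surj_homD(3)[OF assms(1)] surj_homD(3)[OF assms(2)]]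
  by (intro surj_homI) simp_all

lemma perms_id: "(\<lambda>i\<in>{1..n}. i) \<in> perms n"
  by (auto simp: perms_def bij_betw_def inj_on_def)

lemma perms_comp: "\<sigma> \<in> perms n \<Longrightarrow> \<tau> \<in> perms n \<Longrightarrow> compose {1..n} \<sigma> \<tau> \<in> perms n"
  using bij_betw_compose[of \<tau> "{1..n}" "{1..n}" \<sigma> "{1..n}"]
  by (auto simp: perms_def PiE_iff bij_betw_def compose_eq)

lemma perms_inv:
  assumes "\<sigma> \<in> perms n"
  obtains \<tau> where "\<tau> \<in> perms n" "compose {1..n} \<sigma> \<tau> = (\<lambda>i\<in>{1..n}. i)"
    "compose {1..n} \<tau> \<sigma> = (\<lambda>i\<in>{1..n}. i)"
proof
  let ?t = "\<lambda>i\<in>{1..n}. inv_into {1..n} \<sigma> i"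
  have b: "bij_betw \<sigma> {1..n} {1..n}" using assms by (auto simp: perms_def)
  then have "bij_betw ?t {1..n} {1..n}"
    using bij_betw_inv_into[OF b]
    by (subst bij_betw_cong[of _ _ "inv_into {1..n} \<sigma>"]) auto
  then show "?t \<in> perms n" by (auto simp: perms_def bij_betw_def)
  show "compose {1..n} \<sigma> ?t = (\<lambda>i\<in>{1..n}. i)"
    using b by (intro compose_id_inv_into) (auto simp: bij_betw_def)
  show "compose {1..n} ?t \<sigma> = (\<lambda>i\<in>{1..n}. i)"
    using b by (rule compose_inv_into_id)
qed

lemma injs_perm:
  assumes "x \<in> injs n X" "\<sigma> \<in> perms n"
  shows "compose {1..n} x \<sigma> \<in> injs n X"
  using assms inj_on_compose[of \<sigma> "{1..n}" "{1..n}" x]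
  by (auto simp: injs_def perms_def PiE_iff compose_eq)

lemma injs_comp_id: "x \<in> injs n X \<Longrightarrow> compose {1..n} x (\<lambda>i\<in>{1..n}. i) = x"
  by (auto simp: injs_def PiE_iff intro!: compose_Id)

lemma perms_assoc:
  "\<tau> \<in> perms n \<Longrightarrow> compose {1..n} (compose {1..n} x \<sigma>) \<tau> = compose {1..n} x (compose {1..n} \<sigma> \<tau>)"
  by (rule compose_assoc[symmetric]) (auto simp: perms_def)

lemma equiv_tensor_rel:
  assumes A: "is_functor surj_cat set_cat A"
  shows "equiv (injs n X \<times> fobj A n) (tensor_rel A n X)"
proof (rule equivI)
  show "tensor_rel A n X \<subseteq> (injs n X \<times> fobj A n) \<times> (injs n X \<times> fobj A n)"
  proof
    fix u assume "u \<in> tensor_rel A n X"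
    then obtain x \<sigma> a where *: "u = ((compose {1..n} x \<sigma>, a), (x, fmap A n n \<sigma> a))"
      "x \<in> injs n X" "\<sigma> \<in> perms n" "a \<in> fobj A n" unfolding tensor_rel_def by blast
    show "u \<in> (injs n X \<times> fobj A n) \<times> (injs n X \<times> fobj A n)"
      unfolding *(1)
      by (intro SigmaI injs_perm fmap_surj_mem[OF A perms_surj_hom] *)
  qed
  show "refl_on (injs n X \<times> fobj A n) (tensor_rel A n X)"
  proof (rule refl_onI, clarify)
    fix x a assume x: "x \<in> injs n X" and a: "a \<in> fobj A n"
    have "((compose {1..n} x (\<lambda>i\<in>{1..n}. i), a), (x, fmap A n n (\<lambda>i\<in>{1..n}. i) a))
        \<in> tensor_rel A n X"
      unfolding tensor_rel_def using x a perms_id[of n] by blast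
    then show "((x, a), (x, a)) \<in> tensor_rel A n X"
      unfolding injs_comp_id[OF x] fmap_surj_id[OF A a] .
  qed
  show "sym (tensor_rel A n X)"
  proof (rule symI)
    fix u v assume "(u, v) \<in> tensor_rel A n X"
    then obtain x \<sigma> a where *: "u = (compose {1..n} x \<sigma>, a)" "v = (x, fmap A n n \<sigma> a)"
      "x \<in> injs n X" "\<sigma> \<in> perms n" "a \<in> fobj A n" unfolding tensor_rel_def by blast
    obtain \<tau> where t: "\<tau> \<in> perms n" "compose {1..n} \<sigma> \<tau> = (\<lambda>i\<in>{1..n}. i)"
      "compose {1..n} \<tau> \<sigma> = (\<lambda>i\<in>{1..n}. i)" using perms_inv *(4) by blast
    have 1: "compose {1..n} (compose {1..n} x \<sigma>) \<tau> = x"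
      using *(3) t(1,2) by (simp add: perms_assoc injs_comp_id del: One_nat_def)
    have 2: "fmap A n n \<tau> (fmap A n n \<sigma> a) = a"
      using fmap_surj_comp[OF A perms_surj_hom perms_surj_hom, OF *(4) t(1) *(5)]
      unfolding t(3) fmap_surj_id[OF A *(5)] by (rule sym)
    have "((compose {1..n} (compose {1..n} x \<sigma>) \<tau>, fmap A n n \<sigma> a),
        (compose {1..n} x \<sigma>, fmap A n n \<tau> (fmap A n n \<sigma> a))) \<in> tensor_rel A n X"
      unfolding tensor_rel_def
      using injs_perm[OF *(3,4)] t(1) fmap_surj_mem[OF A perms_surj_hom, OF *(4,5)] by blast
    then show "(v, u) \<in> tensor_rel A n X" unfolding 1 2 *(1,2) .
  qed
  show "trans (tensor_rel A n X)"
  proof (rule transI)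
    fix u v w assume "(u, v) \<in> tensor_rel A n X" "(v, w) \<in> tensor_rel A n X"
    then obtain x \<sigma> a y \<tau> where *: "u = (compose {1..n} x \<sigma>, a)" "v = (x, fmap A n n \<sigma> a)"
      "x \<in> injs n X" "\<sigma> \<in> perms n" "a \<in> fobj A n"
      "x = compose {1..n} y \<tau>" "w = (y, fmap A n n \<tau> (fmap A n n \<sigma> a))"
      "y \<in> injs n X" "\<tau> \<in> perms n" unfolding tensor_rel_def by blast
    have "((compose {1..n} y (compose {1..n} \<tau> \<sigma>), a), (y, fmap A n n (compose {1..n} \<tau> \<sigma>) a))
        \<in> tensor_rel A n X"
      unfolding tensor_rel_def using perms_comp[of \<tau> n \<sigma>] * by blast
    then show "(u, w) \<in> tensor_rel A n X"
      unfolding *(1,6,7) perms_assoc[OF *(4)]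
        fmap_surj_comp[OF A perms_surj_hom perms_surj_hom, OF *(4,9,5)] .
  qed
qed

lemma hat_class_eq_iff:
  assumes A: "is_functor surj_cat set_cat A"
    and "x \<in> injs n X" "a \<in> fobj A n" "y \<in> injs m X" "b \<in> fobj A m"
  shows "hat_class A X n x a = hat_class A X m y b \<longleftrightarrow>
    n = m \<and> (\<exists>\<sigma>\<in>perms n. x = compose {1..n} y \<sigma> \<and> b = fmap A n n \<sigma> a)"
proof (cases "n = m")
  case True
  have "hat_class A X n x a = hat_class A X m y b \<longleftrightarrow> ((x, a), (y, b)) \<in> tensor_rel A n X"
    using assms True unfolding hat_class_def
    by (simp add: eq_equiv_class_iff[OF equiv_tensor_rel[OF A]])
  also have "\<dots> \<longleftrightarrow> (\<exists>\<sigma>\<in>perms n. x = compose {1..n} y \<sigma> \<and> b = fmap A n n \<sigma> a)"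
    using assms True unfolding tensor_rel_def by auto
  finally show ?thesis using True by simp
qed (simp add: hat_class_def)

lemma hat_class_mem:
  assumes "x \<in> injs n X" "a \<in> fobj A n"
  shows "hat_class A X n x a \<in> hat_obj A X"
  using assms by (auto simp: hat_class_def hat_obj_def quotient_def)

lemma hat_objE:
  assumes "t \<in> hat_obj A X"
  obtains n x a where "x \<in> injs n X" "a \<in> fobj A n" "t = hat_class A X n x a"
  using assms by (auto simp: hat_class_def hat_obj_def quotient_def)

lemma surj_inj_factorization:
  fixes f :: "'u \<Rightarrow> 'v"
  assumes "f \<in> X \<rightarrow> Y" "x \<in> injs n X"
  obtains m y \<alpha> where "y \<in> injs m Y" "\<alpha> \<in> Hom surj_cat n m"
    "compose {1..n} f x = compose {1..n} y \<alpha>"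
proof -
  define I where "I = (\<lambda>i. f (x i)) ` {1..n}"
  define m where "m = card I"
  have fin: "finite I" by (simp add: I_def)
  obtain h where h: "bij_betw h {1..m} I"
    using ex_bij_betw_nat_finite_1[OF fin] unfolding m_def by blast
  have hi: "h ` {1..m} = I" "inj_on h {1..m}" using h by (simp_all add: bij_betw_def)
  have IY: "I \<subseteq> Y" using assms by (auto simp: injs_def I_def)
  define y where "y = restrict h {1..m}"
  define \<alpha> where "\<alpha> = (\<lambda>i\<in>{1..n}. inv_into {1..m} h (f (x i)))"
  have "h i \<in> Y" if "i \<in> {1..m}" for i using hi(1) IY that by blast
  then have "y \<in> {1..m} \<rightarrow>\<^sub>E Y" unfolding y_def by (intro restrict_PiE_iff[THEN iffD2]) blast
  moreover have "inj_on y {1..m}"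
    unfolding y_def using hi(2) by (simp add: inj_on_restrict_eq)
  ultimately have y: "y \<in> injs m Y" by (simp add: injs_def)
  have "\<alpha> ` {1..n} = inv_into {1..m} h ` I"
    unfolding \<alpha>_def I_def image_image by (intro image_cong) simp_all
  also have "\<dots> = {1..m}"
    using bij_betw_inv_into[OF h] by (simp add: bij_betw_def)
  finally have im: "\<alpha> ` {1..n} = {1..m}" .
  have a: "\<alpha> \<in> Hom surj_cat n m" by (rule surj_homI[OF im]) (simp add: \<alpha>_def)
  have "compose {1..n} f x = compose {1..n} y \<alpha>"
  proof (unfold compose_def, rule restrict_ext)
    fix i assume i: "i \<in> {1..n}"
    have "\<alpha> i \<in> {1..m}" using im i by blast
    then have "y (\<alpha> i) = h (\<alpha> i)" by (simp add: y_def)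
    also have "\<dots> = h (inv_into {1..m} h (f (x i)))" using i by (simp add: \<alpha>_def)
    also have "\<dots> = f (x i)"
      by (rule f_inv_into_f) (use i in \<open>auto simp: hi(1) I_def simp del: One_nat_def\<close>)
    finally show "f (x i) = y (\<alpha> i)" by simp
  qed
  with y a show ?thesis by (rule that)
qed

lemma hat_map_unique:
  assumes A: "is_functor surj_cat set_cat A" and f: "f \<in> X \<rightarrow> Y"
    and x: "x \<in> injs n X" and a: "a \<in> fobj A n"
    and y: "y \<in> injs m Y" and \<alpha>: "\<alpha> \<in> Hom surj_cat n m"
    and e: "compose {1..n} f x = compose {1..n} y \<alpha>"
    and x': "x' \<in> injs n' X" and a': "a' \<in> fobj A n'"
    and y': "y' \<in> injs m' Y" and \<alpha>': "\<alpha>' \<in> Hom surj_cat n' m'"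
    and e': "compose {1..n'} f x' = compose {1..n'} y' \<alpha>'"
    and eq: "hat_class A X n x a = hat_class A X n' x' a'"
  shows "hat_class A Y m y (fmap A n m \<alpha> a) = hat_class A Y m' y' (fmap A n' m' \<alpha>' a')"
proof -
  from eq obtain \<sigma> where [simp]: "n' = n" and s: "\<sigma> \<in> perms n"
    and xs: "x = compose {1..n} x' \<sigma>" and as: "a' = fmap A n n \<sigma> a"
    using hat_class_eq_iff[OF A x a x' a'] by auto
  have s': "\<And>i. i \<in> {1..n} \<Longrightarrow> \<sigma> i \<in> {1..n}" "\<sigma> ` {1..n} = {1..n}"
    using s by (auto simp: perms_def bij_betw_def)
  have p: "y (\<alpha> i) = f (x i)" if "i \<in> {1..n}" for i
    using fun_cong[OF e, of i] that by (simp add: compose_eq)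
  have p': "y' (\<alpha>' i) = f (x' i)" if "i \<in> {1..n}" for i
    using fun_cong[OF e', of i] that by (simp add: compose_eq)
  have ps: "y (\<alpha> i) = y' (\<alpha>' (\<sigma> i))" if "i \<in> {1..n}" for i
    using p[OF that] p'[OF s'(1)[OF that]] that by (simp add: xs compose_eq)
  have im: "y ` {1..m} = y' ` {1..m'}"
  proof -
    have "y ` {1..m} = (\<lambda>i. y (\<alpha> i)) ` {1..n}"
      by (simp only: surj_homD(3)[OF \<alpha>, symmetric] image_image)
    also have "\<dots> = (\<lambda>i. y' (\<alpha>' (\<sigma> i))) ` {1..n}" using ps by (rule image_cong[OF refl])
    also have "\<dots> = (\<lambda>i. y' (\<alpha>' i)) ` (\<sigma> ` {1..n})" by (simp add: image_image)
    also have "\<dots> = y' ` (\<alpha>' ` {1..n})" unfolding s'(2) by (simp add: image_image)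
    also have "\<dots> = y' ` {1..m'}" using surj_homD(3)[OF \<alpha>'] by simp
    finally show ?thesis .
  qed
  have iy: "inj_on y {1..m}" "inj_on y' {1..m'}" using y y' by (auto simp: injs_def)
  have [simp]: "m' = m"
    using im card_image[OF iy(1)] card_image[OF iy(2)] by simp
  let ?t = "\<lambda>i\<in>{1..m}. inv_into {1..m} y' (y i)"
  have b': "bij_betw y' {1..m} (y' ` {1..m})" using iy by (simp add: bij_betw_def)
  have "bij_betw (inv_into {1..m} y' \<circ> y) {1..m} {1..m}"
    using iy im bij_betw_inv_into[OF b'] by (intro bij_betw_trans[of y]) (auto simp: bij_betw_def)
  then have "bij_betw ?t {1..m} {1..m}" by (subst bij_betw_cong[of _ _ "inv_into {1..m} y' \<circ> y"]) auto
  then have t: "?t \<in> perms m" by (auto simp: perms_def bij_betw_def)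
  have yt': "y' (?t i) = y i" if "i \<in> {1..m}" for i
  proof -
    have "y i \<in> y' ` {1..m}" using im that by auto
    then show ?thesis using that by (simp add: f_inv_into_f)
  qed
  have yt: "y = compose {1..m} y' ?t"
  proof
    fix i show "y i = compose {1..m} y' ?t i"
      using yt'[of i] y by (cases "i \<in> {1..m}")
        (auto simp: compose_def injs_def PiE_iff extensional_def)
  qed
  have ta: "compose {1..n} ?t \<alpha> = compose {1..n} \<alpha>' \<sigma>"
  proof
    fix i show "compose {1..n} ?t \<alpha> i = compose {1..n} \<alpha>' \<sigma> i"
    proof (cases "i \<in> {1..n}")
      case True
      have ai: "\<alpha> i \<in> {1..m}" using surj_homD(1)[OF \<alpha>] True by auto
      have bi: "\<alpha>' (\<sigma> i) \<in> {1..m}" using surj_homD(1)[OF \<alpha>'] s'(1)[OF True] by auto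
      have "?t (\<alpha> i) = inv_into {1..m} y' (y' (\<alpha>' (\<sigma> i)))" using ps[OF True] ai by simp
      also have "\<dots> = \<alpha>' (\<sigma> i)" using iy bi by (intro inv_into_f_f) auto
      finally show ?thesis using True by (simp add: compose_eq)
    qed (auto simp: compose_def)
  qed
  have "fmap A n' m' \<alpha>' a' = fmap A n m (compose {1..n} \<alpha>' \<sigma>) a"
    using fmap_surj_comp[OF A perms_surj_hom[OF s], of \<alpha>' m a] \<alpha>' a as by simp
  also have "\<dots> = fmap A m m ?t (fmap A n m \<alpha> a)"
    unfolding ta[symmetric] by (rule fmap_surj_comp[OF A \<alpha> perms_surj_hom[OF t] a])
  finally show ?thesis
    using hat_class_eq_iff[OF A y fmap_surj_mem[OF A \<alpha> a] y' fmap_surj_mem[OF A \<alpha>' a']] yt t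
    by auto
qed

lemma hat_map_class:
  assumes A: "is_functor surj_cat set_cat A" and f: "f \<in> X \<rightarrow> Y"
    and x: "x \<in> injs n X" and a: "a \<in> fobj A n"
    and y: "y \<in> injs m Y" and \<alpha>: "\<alpha> \<in> Hom surj_cat n m"
    and e: "compose {1..n} f x = compose {1..n} y \<alpha>"
  shows "hat_map A X Y f (hat_class A X n x a) = hat_class A Y m y (fmap A n m \<alpha> a)"
  unfolding hat_map_def restrict_apply'[OF hat_class_mem[OF x a]]
proof (rule the_equality)
  fix s assume "\<exists>n' x' a' m' y' \<alpha>'. x' \<in> injs n' X \<and> a' \<in> fobj A n' \<and>
      hat_class A X n x a = hat_class A X n' x' a' \<and>
      y' \<in> injs m' Y \<and> \<alpha>' \<in> Hom surj_cat n' m' \<and>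
      compose {1..n'} f x' = compose {1..n'} y' \<alpha>' \<and>
      s = hat_class A Y m' y' (fmap A n' m' \<alpha>' a')"
  then show "s = hat_class A Y m y (fmap A n m \<alpha> a)"
    using hat_map_unique[OF A f x a y \<alpha> e] by metis
qed (use assms in blast)

lemma is_functor_hat:
  assumes A: "is_functor surj_cat set_cat A"
  shows "is_functor set_cat set_cat (hat A)"
proof -
  have mem: "hat_map A X Y f \<in> hat_obj A X \<rightarrow>\<^sub>E hat_obj A Y" if f: "f \<in> X \<rightarrow>\<^sub>E Y"
    for X Y :: "'b set" and f
  proof
    have f': "f \<in> X \<rightarrow> Y" using f by auto
    fix t assume "t \<in> hat_obj A X"
    then obtain n x a where x: "x \<in> injs n X" and a: "a \<in> fobj A n"
      and t: "t = hat_class A X n x a" by (rule hat_objE)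
    obtain m y \<alpha> where y: "y \<in> injs m Y" and \<alpha>: "\<alpha> \<in> Hom surj_cat n m"
      and e: "compose {1..n} f x = compose {1..n} y \<alpha>"
      using surj_inj_factorization[OF f' x] .
    show "hat_map A X Y f t \<in> hat_obj A Y"
      unfolding t hat_map_class[OF A f' x a y \<alpha> e]
      by (rule hat_class_mem[OF y fmap_surj_mem[OF A \<alpha> a]])
  qed (simp add: hat_map_def)
  have ident: "hat_map A X X (\<lambda>x\<in>X. x) = (\<lambda>t\<in>hat_obj A X. t)" for X :: "'b set"
  proof
    fix t show "hat_map A X X (\<lambda>x\<in>X. x) t = (\<lambda>t\<in>hat_obj A X. t) t"
    proof (cases "t \<in> hat_obj A X")
      case True
      then obtain n x a where x: "x \<in> injs n X" and a: "a \<in> fobj A n"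
        and t: "t = hat_class A X n x a" by (rule hat_objE)
      have "compose {1..n} (\<lambda>x\<in>X. x) x = compose {1..n} x (\<lambda>i\<in>{1..n}. i)"
        using x injs_comp_id[OF x] Id_compose[of x "{1..n}" X] by (simp add: injs_def PiE_iff Pi_iff)
      then show ?thesis
        using hat_map_class[OF A _ x a x perms_surj_hom[OF perms_id], of "\<lambda>x\<in>X. x"] True
          fmap_surj_id[OF A a] by (simp add: t)
    qed (simp add: hat_map_def)
  qed
  have comp: "hat_map A X Z (compose X g f)
      = compose (hat_obj A X) (hat_map A Y Z g) (hat_map A X Y f)"
    if f: "f \<in> X \<rightarrow>\<^sub>E Y" and g: "g \<in> Y \<rightarrow>\<^sub>E Z" for X Y Z :: "'b set" and f g
  proof
    have f': "f \<in> X \<rightarrow> Y" and g': "g \<in> Y \<rightarrow> Z" and gf: "compose X g f \<in> X \<rightarrow> Z"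
      using f g by (auto simp: compose_eq)
    fix t show "hat_map A X Z (compose X g f) t
        = compose (hat_obj A X) (hat_map A Y Z g) (hat_map A X Y f) t"
    proof (cases "t \<in> hat_obj A X")
      case True
      then obtain n x a where x: "x \<in> injs n X" and a: "a \<in> fobj A n"
        and t: "t = hat_class A X n x a" by (rule hat_objE)
      obtain m y \<alpha> where y: "y \<in> injs m Y" and \<alpha>: "\<alpha> \<in> Hom surj_cat n m"
        and e: "compose {1..n} f x = compose {1..n} y \<alpha>"
        using surj_inj_factorization[OF f' x] .
      obtain k z \<beta> where z: "z \<in> injs k Z" and \<beta>: "\<beta> \<in> Hom surj_cat m k"
        and e2: "compose {1..m} g y = compose {1..m} z \<beta>"
        using surj_inj_factorization[OF g' y] .
      have "compose {1..n} (compose X g f) x = compose {1..n} g (compose {1..n} f x)"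
        using x by (intro compose_assoc[symmetric]) (auto simp: injs_def)
      also have "\<dots> = compose {1..n} (compose {1..m} g y) \<alpha>"
        unfolding e using surj_homD(1)[OF \<alpha>] by (intro compose_assoc)
      also have "\<dots> = compose {1..n} z (compose {1..n} \<beta> \<alpha>)"
        unfolding e2 using surj_homD(1)[OF \<alpha>] by (intro compose_assoc[symmetric])
      finally have e3: "compose {1..n} (compose X g f) x = compose {1..n} z (compose {1..n} \<beta> \<alpha>)" .
      show ?thesis
        using True unfolding t
        by (simp add: compose_eq hat_map_class[OF A f' x a y \<alpha> e]
            hat_map_class[OF A g' y fmap_surj_mem[OF A \<alpha> a] z \<beta> e2]
            hat_map_class[OF A gf x a z surj_hom_comp[OF \<alpha> \<beta>] e3]
            fmap_surj_comp[OF A \<alpha> \<beta> a] del: One_nat_def)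
    qed (simp add: hat_map_def compose_def)
  qed
  show ?thesis
    unfolding is_functor_def using mem ident comp
    by (simp add: set_cat_def hat_def)
qed


section \<open>The condition on the functor on surjections\<close>

text \<open>
  The square is a pullback in \<^const>\<open>fin_cat\<close>; its arrows are moreover in \<^const>\<open>surj_cat\<close>.
\<close>

definition WPB :: "'a surj_functor \<Rightarrow> bool" where
  "WPB A \<longleftrightarrow>
     (\<forall>p m n k g2 f2 f1 g1.
        is_pullback fin_cat p m n k g2 f2 f1 g1 \<and>
        g2 \<in> Hom surj_cat p m \<and> f2 \<in> Hom surj_cat p n \<and>
        f1 \<in> Hom surj_cat m k \<and> g1 \<in> Hom surj_cat n k \<longrightarrow>
        (\<forall>a\<in>fobj A m. \<forall>b\<in>fobj A n. fmap A m k f1 a = fmap A n k g1 b \<longrightarrow>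
           (\<exists>q h. \<exists>c\<in>fobj A q.
              h \<in> Hom fin_cat q p \<and> inj_on h {1..q} \<and>
              Cmp fin_cat q f2 h \<in> Hom surj_cat q n \<and>
              Cmp fin_cat q g2 h \<in> Hom surj_cat q m \<and>
              fmap A q m (Cmp fin_cat q g2 h) c = a \<and>
              fmap A q n (Cmp fin_cat q f2 h) c = b)))"

end

theory Submission
  imports Defs
begin

text \<open>
  In both \<open>set_cat\<close> and \<open>fin_cat\<close>, (weak) pullbacks can be tested on points.  The equality
  \<open>hat A f [x, a] = [y, b]\<close> holds iff \<open>f \<circ> x = y \<circ> \<alpha>\<close> and \<open>A \<alpha> a = b\<close> for some surjection \<open>\<alpha>\<close>.
  Hence an equation \<open>hat A f [x, a] = hat A g [y, b]\<close> over a pullback square of sets amounts to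
  surjections \<open>f1\<close>, \<open>g1\<close> with \<open>A f1 a = A g1 b\<close>.  Their pullback embeds into the given one, and a
  common preimage of \<open>[x, a]\<close> and \<open>[y, b]\<close> is the same as the pair \<open>(h, c)\<close> of the condition.
  Conversely, as the universe is infinite, it contains a copy of every pullback square of finite
  ordinals.
\<close>

text \<open>Keeps the simplifier from turning the lower end of \<open>{1..n}\<close> into
  \<open>Suc 0\<close>, so that intervals in goals still match those in the facts.\<close>

declare One_nat_def [simp del]

subsection \<open>Pullbacks tested on points\<close>

lemma compose_eq_iff: "compose W f u = compose W g v \<longleftrightarrow> (\<forall>i\<in>W. f (u i) = g (v i))"
  by (auto simp: compose_def fun_eq_iff restrict_def)

lemma compose_eq_ext_iff:
  "u \<in> extensional W \<Longrightarrow> compose W f v = u \<longleftrightarrow> (\<forall>i\<in>W. f (v i) = u i)"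
  by (auto simp: compose_def fun_eq_iff restrict_def extensional_def)

text \<open>A map into \<open>P\<close> is a family of points of \<open>P\<close>, and here each
  point is forced by its two projections. Since \<open>W\<close> is any set, the argument covers
  both \<open>set_cat\<close> and \<open>fin_cat\<close>.\<close>

lemma ex1_PiE_lift:
  assumes points: "\<forall>x\<in>X. \<forall>y\<in>Y. f x = g y \<longrightarrow> (\<exists>!i. i \<in> P \<and> p i = x \<and> q i = y)"
    and u: "u \<in> W \<rightarrow>\<^sub>E X" and v: "v \<in> W \<rightarrow>\<^sub>E Y" and e: "compose W f u = compose W g v"
  shows "\<exists>!w. w \<in> W \<rightarrow>\<^sub>E P \<and> compose W p w = u \<and> compose W q w = v"
proof -
  have ex1: "\<exists>!i. i \<in> P \<and> p i = u j \<and> q i = v j" if "j \<in> W" for j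
    using points u v e that by (auto simp: compose_eq_iff PiE_iff)
  then have "\<forall>j\<in>W. \<exists>i. i \<in> P \<and> p i = u j \<and> q i = v j" by blast
  then obtain w where w: "\<forall>j\<in>W. w j \<in> P \<and> p (w j) = u j \<and> q (w j) = v j"
    by (auto dest!: bchoice)
  have c: "w' \<in> W \<rightarrow>\<^sub>E P \<and> compose W p w' = u \<and> compose W q w' = v \<longleftrightarrow>
      w' \<in> extensional W \<and> (\<forall>j\<in>W. w' j \<in> P \<and> p (w' j) = u j \<and> q (w' j) = v j)" for w'
    using u v by (auto simp: compose_eq_ext_iff PiE_iff)
  show ?thesis
    unfolding c
  \<comment> \<open>Outside \<open>W\<close> an arrow must be \<open>undefined\<close>, whereas the
    choice function \<open>w\<close> is arbitrary there.\<close>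
  proof (rule ex1I[of _ "restrict w W"])
    fix w' assume w': "w' \<in> extensional W \<and>
      (\<forall>j\<in>W. w' j \<in> P \<and> p (w' j) = u j \<and> q (w' j) = v j)"
    show "w' = restrict w W"
    proof (rule extensionalityI[of _ W])
      show "w' j = restrict w W j" if "j \<in> W" for j
        using ex1[OF that] w w' that by (metis restrict_apply')
    qed (use w' in auto)
  qed (use w in auto)
qed

text \<open>Maps out of a one-point set are points, so the universal property at the test object
  \<open>{a}\<close> is already the elementwise one.\<close>

lemma ex1_point:
  assumes lift: "\<And>u v. u \<in> {a} \<rightarrow>\<^sub>E X \<Longrightarrow> v \<in> {a} \<rightarrow>\<^sub>E Y \<Longrightarrow> compose {a} f u = compose {a} g v \<Longrightarrow>
      \<exists>!w. w \<in> {a} \<rightarrow>\<^sub>E P \<and> compose {a} p w = u \<and> compose {a} q w = v"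
    and "x \<in> X" "y \<in> Y" "f x = g y"
  shows "\<exists>!i. i \<in> P \<and> p i = x \<and> q i = y"
proof -
  have c: "w \<in> {a} \<rightarrow>\<^sub>E P \<and> compose {a} p w = (\<lambda>_\<in>{a}. x) \<and> compose {a} q w = (\<lambda>_\<in>{a}. y) \<longleftrightarrow>
      w \<in> {a} \<rightarrow>\<^sub>E P \<and> p (w a) = x \<and> q (w a) = y" for w
    by (simp add: compose_eq_ext_iff)
  have "\<exists>!w. w \<in> {a} \<rightarrow>\<^sub>E P \<and> compose {a} p w = (\<lambda>_\<in>{a}. x) \<and> compose {a} q w = (\<lambda>_\<in>{a}. y)"
    by (rule lift) (use assms(2-) in \<open>simp_all add: compose_eq_iff\<close>)
  then obtain w where w: "w \<in> {a} \<rightarrow>\<^sub>E P" "p (w a) = x" "q (w a) = y"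
    and uniq: "\<And>w'. w' \<in> {a} \<rightarrow>\<^sub>E P \<Longrightarrow> p (w' a) = x \<Longrightarrow> q (w' a) = y \<Longrightarrow> w' = w"
    unfolding c by (elim ex1E) blast
  show ?thesis
  proof (rule ex1I[of _ "w a"])
    fix i assume "i \<in> P \<and> p i = x \<and> q i = y"
    \<comment> \<open>A competing point is a competing constant map, and the uniqueness of
      \<open>w\<close> applies to it.\<close>
    then have "(\<lambda>_\<in>{a}. i) = w" by (intro uniq) auto
    from fun_cong[OF this, of a] show "i = w a" by simp
  qed (use w in auto)
qed

text \<open>The common elementwise form of pullbacks in \<open>set_cat\<close> and
  \<open>fin_cat\<close>, through which squares are moved between the two categories.\<close>

definition set_pullback ::
  "'p set \<Rightarrow> 'x set \<Rightarrow> 'y set \<Rightarrow> 'z set \<Rightarrow> ('p \<Rightarrow> 'x) \<Rightarrow> ('p \<Rightarrow> 'y) \<Rightarrow> ('x \<Rightarrow> 'z) \<Rightarrow> ('y \<Rightarrow> 'z) \<Rightarrow> bool"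
where
  "set_pullback P X Y Z p q f g \<longleftrightarrow>
     p \<in> P \<rightarrow>\<^sub>E X \<and> q \<in> P \<rightarrow>\<^sub>E Y \<and> f \<in> X \<rightarrow>\<^sub>E Z \<and> g \<in> Y \<rightarrow>\<^sub>E Z \<and>
     (\<forall>i\<in>P. f (p i) = g (q i)) \<and>
     (\<forall>x\<in>X. \<forall>y\<in>Y. f x = g y \<longrightarrow> (\<exists>!i. i \<in> P \<and> p i = x \<and> q i = y))"

lemma is_pullback_set_cat_iff:
  fixes P X Y Z :: "'u set"
  shows "is_pullback set_cat P X Y Z p q f g \<longleftrightarrow> set_pullback P X Y Z p q f g"
proof
  assume pb: "is_pullback set_cat P X Y Z p q f g"
  have lift: "\<forall>W :: 'u set. \<forall>u\<in>W \<rightarrow>\<^sub>E X. \<forall>v\<in>W \<rightarrow>\<^sub>E Y. compose W f u = compose W g v \<longrightarrow>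
      (\<exists>!w. w \<in> W \<rightarrow>\<^sub>E P \<and> compose W p w = u \<and> compose W q w = v)"
    using pb by (simp add: is_pullback_def set_cat_def)
  have "\<exists>!i. i \<in> P \<and> p i = x \<and> q i = y" if "x \<in> X" "y \<in> Y" "f x = g y" for x y
    \<comment> \<open>\<open>undefined\<close> is just some element of the nonempty universe, from
      which a one-point test object is formed.\<close>
    by (rule ex1_point[where a = "undefined :: 'u" and f = f and g = g, OF _ that])
      (rule lift[rule_format])
  then show "set_pullback P X Y Z p q f g"
    using pb by (simp add: set_pullback_def is_pullback_def is_commuting_square_def set_cat_def
        compose_eq_iff)
next
  assume pb: "set_pullback P X Y Z p q f g"
  then have points: "\<forall>x\<in>X. \<forall>y\<in>Y. f x = g y \<longrightarrow> (\<exists>!i. i \<in> P \<and> p i = x \<and> q i = y)"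
    by (simp add: set_pullback_def)
  have "is_commuting_square set_cat P X Y Z p q f g"
    using pb by (simp add: set_pullback_def is_commuting_square_def set_cat_def compose_eq_iff)
  then show "is_pullback set_cat P X Y Z p q f g"
    unfolding is_pullback_def
    by (intro conjI ballI impI) (simp_all add: set_cat_def ex1_PiE_lift[OF points])
qed

lemma is_pullback_fin_cat_iff:
  "is_pullback fin_cat p m n k g2 f2 f1 g1 \<longleftrightarrow>
     set_pullback {1..p} {1..m} {1..n} {1..k} g2 f2 f1 g1"
proof
  assume pb: "is_pullback fin_cat p m n k g2 f2 f1 g1"
  have lift: "\<forall>l :: nat. \<forall>u\<in>{1..l} \<rightarrow>\<^sub>E {1..m}. \<forall>v\<in>{1..l} \<rightarrow>\<^sub>E {1..n}.
      compose {1..l} f1 u = compose {1..l} g1 v \<longrightarrow>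
      (\<exists>!w. w \<in> {1..l} \<rightarrow>\<^sub>E {1..p} \<and> compose {1..l} g2 w = u \<and> compose {1..l} f2 w = v)"
    using pb by (simp add: is_pullback_def fin_cat_def)
  have "\<exists>!l. l \<in> {1..p} \<and> g2 l = i \<and> f2 l = j"
    if ij: "i \<in> {1..m}" "j \<in> {1..n}" "f1 i = g1 j" for i j
  \<comment> \<open>The test object is the ordinal 1, whose underlying set \<open>{1..1}\<close> is
    \<open>{1}\<close>.\<close>
  proof (rule ex1_point[where a = "1 :: nat" and f = f1 and g = g1, OF _ ij])
    show "\<exists>!w. w \<in> {1} \<rightarrow>\<^sub>E {1..p} \<and> compose {1} g2 w = u \<and> compose {1} f2 w = v"
      if "u \<in> {1} \<rightarrow>\<^sub>E {1..m}" "v \<in> {1} \<rightarrow>\<^sub>E {1..n}" "compose {1} f1 u = compose {1} g1 v"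
      for u v :: "nat \<Rightarrow> nat"
      using lift[rule_format, of u 1 v] that by simp
  qed
  then show "set_pullback {1..p} {1..m} {1..n} {1..k} g2 f2 f1 g1"
    using pb by (simp add: set_pullback_def is_pullback_def is_commuting_square_def fin_cat_def
        compose_eq_iff)
next
  assume pb: "set_pullback {1..p} {1..m} {1..n} {1..k} g2 f2 f1 g1"
  then have points: "\<forall>i\<in>{1..m}. \<forall>j\<in>{1..n}. f1 i = g1 j \<longrightarrow>
      (\<exists>!l. l \<in> {1..p} \<and> g2 l = i \<and> f2 l = j)"
    by (simp add: set_pullback_def)
  have "is_commuting_square fin_cat p m n k g2 f2 f1 g1"
    using pb by (simp add: set_pullback_def is_commuting_square_def fin_cat_def compose_eq_iff)
  then show "is_pullback fin_cat p m n k g2 f2 f1 g1"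
    unfolding is_pullback_def
    by (intro conjI ballI impI) (simp_all add: fin_cat_def ex1_PiE_lift[OF points])
qed

text \<open>A weak lift amounts to choosing a preimage for every matching pair. The commuting part
  stays abstract because functoriality of \<open>hat A\<close> supplies it later.\<close>

lemma is_weak_pullback_set_cat_iff:
  fixes P X Y Z :: "'u set"
  shows "is_weak_pullback set_cat P X Y Z p q f g \<longleftrightarrow>
     is_commuting_square set_cat P X Y Z p q f g \<and>
     (\<forall>x\<in>X. \<forall>y\<in>Y. f x = g y \<longrightarrow> (\<exists>i\<in>P. p i = x \<and> q i = y))"
proof (intro iffI conjI ballI impI)
  fix x y assume wpb: "is_weak_pullback set_cat P X Y Z p q f g"
    and xy: "x \<in> X" "y \<in> Y" "f x = g y"
  let ?W = "{undefined :: 'u}"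
  have "(\<lambda>_\<in>?W. x) \<in> ?W \<rightarrow>\<^sub>E X" "(\<lambda>_\<in>?W. y) \<in> ?W \<rightarrow>\<^sub>E Y"
    "compose ?W f (\<lambda>_\<in>?W. x) = compose ?W g (\<lambda>_\<in>?W. y)"
    using xy by (auto simp: compose_eq_iff)
  moreover have "\<exists>w. w \<in> ?W \<rightarrow>\<^sub>E P \<and> compose ?W p w = u \<and> compose ?W q w = v"
    if "u \<in> ?W \<rightarrow>\<^sub>E X" "v \<in> ?W \<rightarrow>\<^sub>E Y" "compose ?W f u = compose ?W g v" for u v
  proof -
    have "\<forall>W :: 'u set. \<forall>u\<in>W \<rightarrow>\<^sub>E X. \<forall>v\<in>W \<rightarrow>\<^sub>E Y. compose W f u = compose W g v \<longrightarrow>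
        (\<exists>w. w \<in> W \<rightarrow>\<^sub>E P \<and> compose W p w = u \<and> compose W q w = v)"
      using wpb by (simp add: is_weak_pullback_def set_cat_def)
    with that show ?thesis by blast
  qed
  ultimately obtain w where "w \<in> ?W \<rightarrow>\<^sub>E P" "compose ?W p w = (\<lambda>_\<in>?W. x)"
    "compose ?W q w = (\<lambda>_\<in>?W. y)" by metis
  then show "\<exists>i\<in>P. p i = x \<and> q i = y"
    by (intro bexI[of _ "w undefined"]) (auto simp: compose_eq_ext_iff)
next
  assume *: "is_commuting_square set_cat P X Y Z p q f g \<and>
     (\<forall>x\<in>X. \<forall>y\<in>Y. f x = g y \<longrightarrow> (\<exists>i\<in>P. p i = x \<and> q i = y))"
  have "\<exists>w. w \<in> W \<rightarrow>\<^sub>E P \<and> compose W p w = u \<and> compose W q w = v"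
    if u: "u \<in> W \<rightarrow>\<^sub>E X" and v: "v \<in> W \<rightarrow>\<^sub>E Y" and e: "compose W f u = compose W g v"
    for W :: "'u set" and u v
  proof -
    have "\<forall>j\<in>W. \<exists>i. i \<in> P \<and> p i = u j \<and> q i = v j"
      using * u v e by (fastforce simp: compose_eq_iff PiE_iff)
    then obtain w where "\<forall>j\<in>W. w j \<in> P \<and> p (w j) = u j \<and> q (w j) = v j"
      by (auto dest!: bchoice)
    then show ?thesis
      using u v by (intro exI[of _ "restrict w W"]) (auto simp: compose_eq_ext_iff PiE_iff)
  qed
  then show "is_weak_pullback set_cat P X Y Z p q f g"
    using * by (simp add: is_weak_pullback_def set_cat_def)
qed (simp add: is_weak_pullback_def)

text \<open>The matching pairs form a finite set, and enumerating it turns it into an ordinal. A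
  projection is onto because the side opposite to it is: every index on one side has a partner over
  the same value.\<close>

lemma surj_pullback_exists:
  assumes f1: "f1 \<in> Hom surj_cat m k" and g1: "g1 \<in> Hom surj_cat n k"
  obtains p g2 f2 where "set_pullback {1..p} {1..m} {1..n} {1..k} g2 f2 f1 g1"
    "g2 \<in> Hom surj_cat p m" "f2 \<in> Hom surj_cat p n"
proof -
  define I where "I = {(i, j). i \<in> {1..m} \<and> j \<in> {1..n} \<and> f1 i = g1 j}"
  have "I \<subseteq> {1..m} \<times> {1..n}" by (auto simp: I_def)
  then have "finite I" by (rule finite_subset) simp
  then obtain h where h: "bij_betw h {1..card I} I" using ex_bij_betw_nat_finite_1 by blast
  define p where "p = card I"
  note h = h[folded p_def]
  define g2 f2 where "g2 = (\<lambda>l\<in>{1..p}. fst (h l))" and "f2 = (\<lambda>l\<in>{1..p}. snd (h l))"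
  have hI: "h l \<in> I" if "l \<in> {1..p}" for l using h that by (auto simp: bij_betw_def)
  have ex1: "\<exists>!l. l \<in> {1..p} \<and> g2 l = i \<and> f2 l = j" if "(i, j) \<in> I" for i j
  proof -
    have "\<exists>!l. l \<in> {1..p} \<and> h l = (i, j)"
      using h that unfolding bij_betw_iff_bijections by metis
    moreover have "l \<in> {1..p} \<and> g2 l = i \<and> f2 l = j \<longleftrightarrow> l \<in> {1..p} \<and> h l = (i, j)" for l
      by (auto simp: g2_def f2_def prod_eq_iff)
    ultimately show ?thesis by simp
  qed
  have mem: "g2 l \<in> {1..m}" "f2 l \<in> {1..n}" "f1 (g2 l) = g1 (f2 l)" if "l \<in> {1..p}" for l
    using hI[OF that] that by (auto simp: I_def g2_def f2_def)
  show ?thesis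
  proof
    show "set_pullback {1..p} {1..m} {1..n} {1..k} g2 f2 f1 g1"
      unfolding set_pullback_def
    proof (intro conjI ballI impI)
      show "f1 \<in> {1..m} \<rightarrow>\<^sub>E {1..k}" "g1 \<in> {1..n} \<rightarrow>\<^sub>E {1..k}"
        using surj_homD[OF f1] surj_homD[OF g1] by (auto simp: PiE_iff)
      show "g2 \<in> {1..p} \<rightarrow>\<^sub>E {1..m}" "f2 \<in> {1..p} \<rightarrow>\<^sub>E {1..n}"
        using mem by (auto simp: PiE_iff g2_def f2_def)
      show "\<exists>!l. l \<in> {1..p} \<and> g2 l = i \<and> f2 l = j"
        if "i \<in> {1..m}" "j \<in> {1..n}" "f1 i = g1 j" for i j
        by (rule ex1) (use that in \<open>simp add: I_def\<close>)
    qed (rule mem)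
    show "g2 \<in> Hom surj_cat p m"
    proof (rule surj_homI)
      have "i \<in> g2 ` {1..p}" if i: "i \<in> {1..m}" for i
      proof -
        have "f1 i \<in> g1 ` {1..n}"
          using i surj_homD(3)[OF f1] surj_homD(3)[OF g1] by blast
        \<comment> \<open>Surjectivity of \<open>g1\<close> provides the partner \<open>j\<close> of
          \<open>i\<close>.\<close>
        then obtain j where "(i, j) \<in> I" using i by (auto simp: I_def)
        with ex1 show ?thesis by blast
      qed
      then show "g2 ` {1..p} = {1..m}" using mem by blast
    qed (simp add: g2_def)
    show "f2 \<in> Hom surj_cat p n"
    proof (rule surj_homI)
      have "j \<in> f2 ` {1..p}" if j: "j \<in> {1..n}" for j
      proof -
        have "g1 j \<in> f1 ` {1..m}"
          using j surj_homD(3)[OF f1] surj_homD(3)[OF g1] by blast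
        then obtain i where "(i, j) \<in> I" using j by (auto simp: I_def)
        with ex1 show ?thesis by blast
      qed
      then show "f2 ` {1..p} = {1..n}" using mem by blast
    qed (simp add: f2_def)
  qed
qed

subsection \<open>Lifting points along the Kan extension\<close>

lemma compose_injs:
  assumes w: "inj_on w B" "w \<in> B \<rightarrow> X" and h: "inj_on h {1..r}" "h \<in> {1..r} \<rightarrow> B"
  shows "compose {1..r} w h \<in> injs r X"
proof -
  have "inj_on (compose {1..r} w h) {1..r}"
  proof (rule inj_onI)
    fix i j assume ij: "i \<in> {1..r}" "j \<in> {1..r}" "compose {1..r} w h i = compose {1..r} w h j"
    then have "w (h i) = w (h j)" by (simp add: compose_eq)
    with ij h w(1) show "i = j" by (meson Pi_mem inj_onD)
  qed
  moreover have "compose {1..r} w h \<in> {1..r} \<rightarrow>\<^sub>E X"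
    using w(2) h(2) by (auto simp: PiE_iff compose_eq Pi_iff)
  ultimately show ?thesis by (simp add: injs_def)
qed

text \<open>The representative \<open>(y, b)\<close> may be prescribed: the one produced by a
  factorization of \<open>f \<circ> x\<close> differs from it by a permutation, and a surjection
  followed by a permutation is again a surjection.\<close>

lemma hat_map_class_eq_iff:
  assumes A: "is_functor surj_cat set_cat A" and f: "f \<in> X \<rightarrow> Y"
    and x: "x \<in> injs n X" and a: "a \<in> fobj A n"
    and y: "y \<in> injs m Y" and b: "b \<in> fobj A m"
  shows "hat_map A X Y f (hat_class A X n x a) = hat_class A Y m y b \<longleftrightarrow>
    (\<exists>\<alpha>\<in>Hom surj_cat n m. compose {1..n} f x = compose {1..n} y \<alpha> \<and> fmap A n m \<alpha> a = b)"
proof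
  assume eq: "hat_map A X Y f (hat_class A X n x a) = hat_class A Y m y b"
  obtain m' y' \<beta> where y': "y' \<in> injs m' Y" and \<beta>: "\<beta> \<in> Hom surj_cat n m'"
    and e: "compose {1..n} f x = compose {1..n} y' \<beta>"
    using surj_inj_factorization[OF f x] .
  have "hat_class A Y m' y' (fmap A n m' \<beta> a) = hat_class A Y m y b"
    using eq hat_map_class[OF A f x a y' \<beta> e] by simp
  then obtain \<sigma> where m: "m' = m" and \<sigma>: "\<sigma> \<in> perms m" and y'y: "y' = compose {1..m} y \<sigma>"
    and b': "b = fmap A m m \<sigma> (fmap A n m \<beta> a)"
    using hat_class_eq_iff[OF A y' fmap_surj_mem[OF A \<beta> a] y b] by auto
  note \<beta> = \<beta>[unfolded m]
  show "\<exists>\<alpha>\<in>Hom surj_cat n m. compose {1..n} f x = compose {1..n} y \<alpha> \<and> fmap A n m \<alpha> a = b"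
  proof (intro bexI conjI)
    show "compose {1..n} \<sigma> \<beta> \<in> Hom surj_cat n m"
      by (rule surj_hom_comp[OF \<beta> perms_surj_hom[OF \<sigma>]])
    show "compose {1..n} f x = compose {1..n} y (compose {1..n} \<sigma> \<beta>)"
      unfolding e y'y by (rule compose_assoc[OF surj_homD(1)[OF \<beta>], symmetric])
    show "fmap A n m (compose {1..n} \<sigma> \<beta>) a = b"
      unfolding b' by (rule fmap_surj_comp[OF A \<beta> perms_surj_hom[OF \<sigma>] a])
  qed
next
  assume "\<exists>\<alpha>\<in>Hom surj_cat n m. compose {1..n} f x = compose {1..n} y \<alpha> \<and> fmap A n m \<alpha> a = b"
  then show "hat_map A X Y f (hat_class A X n x a) = hat_class A Y m y b"
    using hat_map_class[OF A f x a y] by auto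
qed

lemma functor_commuting_square:
  assumes F: "is_functor C D F" and sq: "is_commuting_square C P X Y Z p q f g"
  shows "is_commuting_square D (fobj F P) (fobj F X) (fobj F Y) (fobj F Z)
    (fmap F P X p) (fmap F P Y q) (fmap F X Z f) (fmap F Y Z g)"
proof -
  have ob: "fobj F U \<in> Obj D" if "U \<in> Obj C" for U
    using F that by (simp add: is_functor_def)
  have hom: "fmap F U V h \<in> Hom D (fobj F U) (fobj F V)"
    if "U \<in> Obj C" "V \<in> Obj C" "h \<in> Hom C U V" for U V h
    using F that by (simp add: is_functor_def)
  have comp: "Cmp D (fobj F U) (fmap F V W h') (fmap F U V h) = fmap F U W (Cmp C U h' h)"
    if "U \<in> Obj C" "V \<in> Obj C" "W \<in> Obj C" "h \<in> Hom C U V" "h' \<in> Hom C V W" for U V W h h'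
    using F that unfolding is_functor_def by metis
  show ?thesis
    using sq by (simp add: is_commuting_square_def ob hom comp)
qed

text \<open>The indices of \<open>x\<close> and \<open>y\<close> with equal images in
  \<open>Z\<close> form a pullback of surjections. \<open>WPB\<close> supplies an element
  \<open>c\<close> over some of these index pairs, and the pairs embed into \<open>P\<close> because
  the square of sets is a pullback.\<close>

lemma hat_point_lift:
  assumes A: "is_functor surj_cat set_cat A" and wpb: "WPB A"
    and pb: "set_pullback P X Y Z p q f g"
    and t: "t \<in> hat_obj A X" and s: "s \<in> hat_obj A Y"
    and eq: "hat_map A X Z f t = hat_map A Y Z g s"
  shows "\<exists>r\<in>hat_obj A P. hat_map A P X p r = t \<and> hat_map A P Y q r = s"
proof -
  have p: "p \<in> P \<rightarrow> X" and q: "q \<in> P \<rightarrow> Y" and f: "f \<in> X \<rightarrow> Z" and g: "g \<in> Y \<rightarrow> Z"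
    and points: "\<And>x y. x \<in> X \<Longrightarrow> y \<in> Y \<Longrightarrow> f x = g y \<Longrightarrow> \<exists>i\<in>P. p i = x \<and> q i = y"
    using pb by (auto simp: set_pullback_def PiE_iff) blast
  obtain m x a where x: "x \<in> injs m X" and a: "a \<in> fobj A m" and t': "t = hat_class A X m x a"
    using t by (rule hat_objE)
  obtain n y b where y: "y \<in> injs n Y" and b: "b \<in> fobj A n" and s': "s = hat_class A Y n y b"
    using s by (rule hat_objE)
  obtain k z f1 where z: "z \<in> injs k Z" and f1: "f1 \<in> Hom surj_cat m k"
    and fx: "compose {1..m} f x = compose {1..m} z f1"
    using surj_inj_factorization[OF f x] .
  \<comment> \<open>Writing both images with the same injection \<open>z\<close> gives
    \<open>f1\<close> and \<open>g1\<close> a common target and makes the equation in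
    \<open>A\<close> literal.\<close>
  have "hat_map A Y Z g (hat_class A Y n y b) = hat_class A Z k z (fmap A m k f1 a)"
    using eq hat_map_class[OF A f x a z f1 fx] by (simp add: t' s')
  then obtain g1 where g1: "g1 \<in> Hom surj_cat n k"
    and gy: "compose {1..n} g y = compose {1..n} z g1" and ab: "fmap A m k f1 a = fmap A n k g1 b"
    using hat_map_class_eq_iff[OF A g y b z fmap_surj_mem[OF A f1 a]] by auto
  obtain l g2 f2 where pb1: "set_pullback {1..l} {1..m} {1..n} {1..k} g2 f2 f1 g1"
    and g2: "g2 \<in> Hom surj_cat l m" and f2: "f2 \<in> Hom surj_cat l n"
    using surj_pullback_exists[OF f1 g1] .
  have "is_pullback fin_cat l m n k g2 f2 f1 g1" using pb1 by (simp add: is_pullback_fin_cat_iff)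
  then obtain r h c where c: "c \<in> fobj A r" and h: "h \<in> {1..r} \<rightarrow>\<^sub>E {1..l}" and hi: "inj_on h {1..r}"
    and f2h: "compose {1..r} f2 h \<in> Hom surj_cat r n"
    and g2h: "compose {1..r} g2 h \<in> Hom surj_cat r m"
    and ca: "fmap A r m (compose {1..r} g2 h) c = a"
    and cb: "fmap A r n (compose {1..r} f2 h) c = b"
    using wpb[unfolded WPB_def, rule_format, OF _ a b ab, of l g2 f2] g2 f2 f1 g1
    by (auto simp: fin_cat_def)
  have hl: "h j \<in> {1..l}" if "j \<in> {1..r}" for j using h that by blast
  have g2m: "g2 i \<in> {1..m}" and f2n: "f2 i \<in> {1..n}" if "i \<in> {1..l}" for i
    using surj_homD(1)[OF g2] surj_homD(1)[OF f2] that by auto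
  \<comment> \<open>Each index pair labels two elements of \<open>X\<close> and \<open>Y\<close>
    that agree in \<open>Z\<close>, hence a point of \<open>P\<close>.\<close>
  have "\<forall>i\<in>{1..l}. \<exists>w. w \<in> P \<and> p w = x (g2 i) \<and> q w = y (f2 i)"
  proof
    fix i assume i: "i \<in> {1..l}"
    have "x (g2 i) \<in> X" "y (f2 i) \<in> Y" using x y g2m[OF i] f2n[OF i] by (auto simp: injs_def)
    moreover have "f (x (g2 i)) = g (y (f2 i))"
      using fx gy pb1 i g2m[OF i] f2n[OF i] by (simp add: compose_eq_iff set_pullback_def)
    ultimately show "\<exists>w. w \<in> P \<and> p w = x (g2 i) \<and> q w = y (f2 i)" using points by blast
  qed
  from bchoice[OF this] obtain w
    where w: "\<And>i. i \<in> {1..l} \<Longrightarrow> w i \<in> P \<and> p (w i) = x (g2 i) \<and> q (w i) = y (f2 i)"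
    by blast
  \<comment> \<open>The point determines both labels, these determine the two indices since
    \<open>x\<close> and \<open>y\<close> are injective, and the indices determine the pair.\<close>
  have "inj_on w {1..l}"
  proof (rule inj_onI)
    fix i j assume i: "i \<in> {1..l}" and j: "j \<in> {1..l}" and "w i = w j"
    then have "x (g2 i) = x (g2 j)" "y (f2 i) = y (f2 j)" using w by metis+
    then have "g2 i = g2 j" "f2 i = f2 j"
      using x y g2m f2n i j by (auto simp: injs_def dest: inj_onD)
    moreover have "\<exists>!l'. l' \<in> {1..l} \<and> g2 l' = g2 j \<and> f2 l' = f2 j"
      using pb1 g2m[OF j] f2n[OF j] j unfolding set_pullback_def by blast
    ultimately show "i = j" using i j by blast
  qed
  then have wh: "compose {1..r} w h \<in> injs r P"
    using w h hi by (intro compose_injs[of w "{1..l}"]) auto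
  \<comment> \<open>\<open>p \<circ> w \<circ> h\<close> equals
    \<open>x \<circ> g2 \<circ> h\<close>, so the surjection that the criterion asks for is
    \<open>g2 \<circ> h\<close>.\<close>
  have "hat_map A P X p (hat_class A P r (compose {1..r} w h) c) = t"
    unfolding t' hat_map_class_eq_iff[OF A p wh c x a]
    by (rule bexI[OF _ g2h]) (use w hl ca in \<open>auto simp: compose_eq_iff compose_eq\<close>)
  moreover have "hat_map A P Y q (hat_class A P r (compose {1..r} w h) c) = s"
    unfolding s' hat_map_class_eq_iff[OF A q wh c y b]
    by (rule bexI[OF _ f2h]) (use w hl cb in \<open>auto simp: compose_eq_iff compose_eq\<close>)
  ultimately show ?thesis using hat_class_mem[OF wh c] by blast
qed

subsection \<open>Copies of finite squares in an infinite universe\<close>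

text \<open>For injective \<open>e\<close>, the conjugate of \<open>f\<close> by \<open>e\<close>.
  One \<open>e\<close> serves all ordinals, so composable arrows stay composable after
  copying.\<close>

definition transport :: "(nat \<Rightarrow> 'u) \<Rightarrow> nat \<Rightarrow> (nat \<Rightarrow> nat) \<Rightarrow> 'u \<Rightarrow> 'u" where
  "transport e n f = (\<lambda>u\<in>e ` {1..n}. e (f (inv e u)))"

lemma transport_apply:
  "inj e \<Longrightarrow> i \<in> {1..n} \<Longrightarrow> transport e n f (e i) = e (f i)"
  by (simp add: transport_def)

lemma transport_PiE:
  "inj e \<Longrightarrow> f \<in> {1..n} \<rightarrow> {1..m} \<Longrightarrow> transport e n f \<in> e ` {1..n} \<rightarrow>\<^sub>E e ` {1..m}"
  by (auto simp: transport_def)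

text \<open>Conjugation by an injection is an isomorphism of squares, and every point of a copied
  set has the form \<open>e i\<close> for a unique \<open>i\<close>.\<close>

lemma set_pullback_transport:
  assumes e: "inj e" and pb: "set_pullback {1..p} {1..m} {1..n} {1..k} g2 f2 f1 g1"
  shows "set_pullback (e ` {1..p}) (e ` {1..m}) (e ` {1..n}) (e ` {1..k})
    (transport e p g2) (transport e p f2) (transport e m f1) (transport e n g1)"
  unfolding set_pullback_def
proof (intro conjI)
  show "transport e p g2 \<in> e ` {1..p} \<rightarrow>\<^sub>E e ` {1..m}" "transport e p f2 \<in> e ` {1..p} \<rightarrow>\<^sub>E e ` {1..n}"
    "transport e m f1 \<in> e ` {1..m} \<rightarrow>\<^sub>E e ` {1..k}" "transport e n g1 \<in> e ` {1..n} \<rightarrow>\<^sub>E e ` {1..k}"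
    by (intro transport_PiE[OF e]; use pb in \<open>simp add: set_pullback_def PiE_def\<close>)+
  have g2m: "g2 i \<in> {1..m}" and f2n: "f2 i \<in> {1..n}" and sq: "f1 (g2 i) = g1 (f2 i)"
    if "i \<in> {1..p}" for i
    using pb that by (auto simp: set_pullback_def PiE_iff)
  show "\<forall>u\<in>e ` {1..p}. transport e m f1 (transport e p g2 u) = transport e n g1 (transport e p f2 u)"
    using g2m f2n sq by (auto simp: transport_apply[OF e] simp del: atLeastAtMost_iff)
  have "\<exists>!u. u \<in> e ` {1..p} \<and> transport e p g2 u = e i \<and> transport e p f2 u = e j"
    if ij: "i \<in> {1..m}" "j \<in> {1..n}" "f1 i = g1 j" for i j
  proof -
    have "\<exists>!l. l \<in> {1..p} \<and> g2 l = i \<and> f2 l = j"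
      using pb ij unfolding set_pullback_def by blast
    then obtain l where l: "l \<in> {1..p}" "g2 l = i" "f2 l = j"
      and uniq: "\<And>l'. l' \<in> {1..p} \<Longrightarrow> g2 l' = i \<Longrightarrow> f2 l' = j \<Longrightarrow> l' = l" by metis
    show ?thesis
    proof (rule ex1I[of _ "e l"])
      fix u assume u: "u \<in> e ` {1..p} \<and> transport e p g2 u = e i \<and> transport e p f2 u = e j"
      then obtain l' where l': "u = e l'" "l' \<in> {1..p}" by blast
      have "g2 l' = i" "f2 l' = j"
        using u by (simp_all add: l'(1) transport_apply[OF e l'(2)] inj_eq[OF e])
      with uniq l' show "u = e l" by blast
    next
      show "e l \<in> e ` {1..p} \<and> transport e p g2 (e l) = e i \<and> transport e p f2 (e l) = e j"
        using l by (simp add: transport_apply[OF e l(1)] del: atLeastAtMost_iff)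
    qed
  qed
  then show "\<forall>u\<in>e ` {1..m}. \<forall>v\<in>e ` {1..n}. transport e m f1 u = transport e n g1 v \<longrightarrow>
      (\<exists>!w. w \<in> e ` {1..p} \<and> transport e p g2 w = u \<and> transport e p f2 w = v)"
    by (simp add: transport_apply[OF e] inj_eq[OF e] del: atLeastAtMost_iff)
qed

text \<open>Cancelling \<open>e\<close> leaves \<open>f \<circ> h\<close> as the only candidate for
  the surjection in \<open>hat_map_class_eq_iff\<close>, so the existential collapses to the clauses
  that \<open>WPB\<close> demands of \<open>(h, c)\<close>.\<close>

lemma hat_map_transport_iff:
  fixes e :: "nat \<Rightarrow> 'u"
  assumes A: "is_functor surj_cat set_cat A" and e: "inj e"
    and f: "f \<in> {1..n} \<rightarrow> {1..m}" and h: "h \<in> {1..r} \<rightarrow>\<^sub>E {1..n}" "inj_on h {1..r}"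
    and c: "c \<in> fobj A r" and b: "b \<in> fobj A m"
  shows "hat_map A (e ` {1..n}) (e ` {1..m}) (transport e n f)
      (hat_class A (e ` {1..n}) r (compose {1..r} e h) c)
      = hat_class A (e ` {1..m}) m (restrict e {1..m}) b \<longleftrightarrow>
    compose {1..r} f h \<in> Hom surj_cat r m \<and> fmap A r m (compose {1..r} f h) c = b"
proof -
  have em: "restrict e {1..m} \<in> injs m (e ` {1..m})"
    using inj_on_subset[OF e] by (auto simp: injs_def)
  have eh: "compose {1..r} e h \<in> injs r (e ` {1..n})"
    using h by (intro compose_injs[of e "{1..n}"] inj_on_subset[OF e]) auto
  have t: "transport e n f \<in> e ` {1..n} \<rightarrow> e ` {1..m}" using transport_PiE[OF e f] by auto
  have hn: "h i \<in> {1..n}" if "i \<in> {1..r}" for i using h that by blast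
  have "compose {1..r} (transport e n f) (compose {1..r} e h)
      = compose {1..r} (restrict e {1..m}) \<alpha> \<longleftrightarrow> \<alpha> = compose {1..r} f h"
    if \<alpha>: "\<alpha> \<in> Hom surj_cat r m" for \<alpha>
  proof -
    have "\<alpha> i \<in> {1..m}" if "i \<in> {1..r}" for i using surj_homD(1)[OF \<alpha>] that by blast
    then have "compose {1..r} (transport e n f) (compose {1..r} e h)
        = compose {1..r} (restrict e {1..m}) \<alpha> \<longleftrightarrow> (\<forall>i\<in>{1..r}. e (f (h i)) = e (\<alpha> i))"
      by (simp add: compose_eq_iff compose_eq transport_apply[OF e hn] del: atLeastAtMost_iff)
    also have "\<dots> \<longleftrightarrow> compose {1..r} f h = \<alpha>"
      using surj_homD(2)[OF \<alpha>] e by (simp add: compose_eq_ext_iff inj_eq)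
    finally show ?thesis by auto
  qed
  then show ?thesis
    unfolding hat_map_class_eq_iff[OF A t eh c em b] by auto
qed

text \<open>Pulling \<open>w\<close> back along \<open>e\<close> yields the injection of ordinals
  that \<open>WPB\<close> requires.\<close>

lemma injs_image_factor:
  assumes e: "inj e" and w: "w \<in> injs r (e ` {1..n})"
  obtains h where "h \<in> {1..r} \<rightarrow>\<^sub>E {1..n}" "inj_on h {1..r}" "w = compose {1..r} e h"
proof
  let ?h = "\<lambda>i\<in>{1..r}. inv e (w i)"
  have w': "w i \<in> e ` {1..n}" if "i \<in> {1..r}" for i using w that by (auto simp: injs_def)
  show "?h \<in> {1..r} \<rightarrow>\<^sub>E {1..n}" using w' e by (force simp: PiE_iff)
  have "e (?h i) = w i" if "i \<in> {1..r}" for i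
    using w'[OF that] that by (auto intro!: f_inv_into_f)
  then show weh: "w = compose {1..r} e ?h"
    using w by (intro extensionalityI[of _ "{1..r}"]) (auto simp: injs_def PiE_iff compose_eq)
  show "inj_on ?h {1..r}"
  proof (rule inj_onI)
    fix i j assume ij: "i \<in> {1..r}" "j \<in> {1..r}" "?h i = ?h j"
    then have "compose {1..r} e ?h i = compose {1..r} e ?h j" by (simp only: compose_eq)
    then have "w i = w j" unfolding weh[symmetric] .
    then show "i = j" using w ij by (auto simp: injs_def dest: inj_onD)
  qed
qed

section \<open>From the condition to all squares of sets, and back by way of copied finite
  squares\<close>

theorem proposition7p2:
  fixes A :: "'a surj_functor"
  assumes "is_functor surj_cat set_cat A"
    and "infinite (UNIV :: 'u set)"
  shows "weakly_preserves_pullbacks (set_cat :: ('u set, 'u \<Rightarrow> 'u) category) set_cat (hat A)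
     \<longleftrightarrow> WPB A"
proof
  note A = assms(1)
  assume wpb: "WPB A"
  show "weakly_preserves_pullbacks (set_cat :: ('u set, 'u \<Rightarrow> 'u) category) set_cat (hat A)"
    unfolding weakly_preserves_pullbacks_def is_weak_pullback_set_cat_iff
  proof (intro allI impI conjI ballI)
    fix P X Y Z :: "'u set" and p q f g t s
    assume pb: "is_pullback set_cat P X Y Z p q f g"
      and "t \<in> fobj (hat A) X" "s \<in> fobj (hat A) Y"
        "fmap (hat A) X Z f t = fmap (hat A) Y Z g s"
    then show "\<exists>i\<in>fobj (hat A) P. fmap (hat A) P X p i = t \<and> fmap (hat A) P Y q i = s"
      using hat_point_lift[OF A wpb pb[unfolded is_pullback_set_cat_iff]] by (simp add: hat_def)
  qed (auto simp: is_pullback_def intro: functor_commuting_square[OF is_functor_hat[OF A]])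
next
  note A = assms(1)
  assume wp: "weakly_preserves_pullbacks (set_cat :: ('u set, 'u \<Rightarrow> 'u) category) set_cat (hat A)"
  \<comment> \<open>An infinite universe has room for copies of all finite ordinals at once.\<close>
  obtain e :: "nat \<Rightarrow> 'u" where e: "inj e"
    using infinite_countable_subset[OF assms(2)] by blast
  show "WPB A"
    unfolding WPB_def
  proof (intro allI impI ballI, elim conjE)
    fix p m n k g2 f2 f1 g1 a b
    assume pb: "is_pullback fin_cat p m n k g2 f2 f1 g1"
      and g2: "g2 \<in> Hom surj_cat p m" and f2: "f2 \<in> Hom surj_cat p n"
      and f1: "f1 \<in> Hom surj_cat m k" and g1: "g1 \<in> Hom surj_cat n k"
      and a: "a \<in> fobj A m" and b: "b \<in> fobj A n" and ab: "fmap A m k f1 a = fmap A n k g1 b"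
    let ?E = "\<lambda>n::nat. e ` {1..n}"
    \<comment> \<open>An element of \<open>fobj A n\<close> is placed in \<open>hat A\<close> with
      the whole copy of \<open>n\<close> as its support.\<close>
    let ?t = "\<lambda>n. hat_class A (?E n) n (restrict e {1..n})"
    \<comment> \<open>This is \<open>hat_map_transport_iff\<close> with the identity as
      \<open>h\<close>: on such elements a copied surjection acts as \<open>A\<close> does.\<close>
    have hat_map_t: "hat_map A (?E i) (?E k) (transport e i f) (?t i d) = ?t k (fmap A i k f d)"
      if f: "f \<in> Hom surj_cat i k" and d: "d \<in> fobj A i" for i f d
    proof -
      have id: "compose {1..i} f (\<lambda>j\<in>{1..i}. j) = f"
        by (rule compose_Id[OF surj_homD(1,2)[OF f]])
      have re: "compose {1..i} e (\<lambda>j\<in>{1..i}. j) = restrict e {1..i}"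
        by (auto simp: compose_def)
      have j: "(\<lambda>j\<in>{1..i}. j) \<in> {1..i} \<rightarrow>\<^sub>E {1..i}" "inj_on (\<lambda>j\<in>{1..i}. j) {1..i}"
        by (auto simp: inj_on_def)
      show ?thesis
        using hat_map_transport_iff[OF A e surj_homD(1)[OF f] j d fmap_surj_mem[OF A f d]] f
        unfolding id re by blast
    qed
    have mem: "?t i d \<in> hat_obj A (?E i)" if "d \<in> fobj A i" for i d
      using e that by (intro hat_class_mem) (auto simp: injs_def inj_on_def)
    have "is_pullback set_cat (?E p) (?E m) (?E n) (?E k)
        (transport e p g2) (transport e p f2) (transport e m f1) (transport e n g1)"
      using set_pullback_transport[OF e] pb
      by (simp add: is_pullback_fin_cat_iff is_pullback_set_cat_iff)
    then have "is_weak_pullback set_cat (hat_obj A (?E p)) (hat_obj A (?E m)) (hat_obj A (?E n))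
        (hat_obj A (?E k)) (hat_map A (?E p) (?E m) (transport e p g2))
        (hat_map A (?E p) (?E n) (transport e p f2)) (hat_map A (?E m) (?E k) (transport e m f1))
        (hat_map A (?E n) (?E k) (transport e n g1))"
      using wp unfolding weakly_preserves_pullbacks_def by (simp add: hat_def)
    \<comment> \<open>By \<open>hat_map_t\<close>, the equation \<open>ab\<close> says that
      \<open>?t m a\<close> and \<open>?t n b\<close> agree over the copy of \<open>k\<close>;
      \<open>r\<close> is a common preimage.\<close>
    then obtain r where r: "r \<in> hat_obj A (?E p)"
      and ra: "hat_map A (?E p) (?E m) (transport e p g2) r = ?t m a"
      and rb: "hat_map A (?E p) (?E n) (transport e p f2) r = ?t n b"
      using mem[OF a] mem[OF b] hat_map_t[OF f1 a] hat_map_t[OF g1 b] ab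
      unfolding is_weak_pullback_set_cat_iff by metis
    obtain q w c where w: "w \<in> injs q (?E p)" and c: "c \<in> fobj A q"
      and rw: "r = hat_class A (?E p) q w c"
      using r by (rule hat_objE)
    obtain h where h: "h \<in> {1..q} \<rightarrow>\<^sub>E {1..p}" "inj_on h {1..q}" and wh: "w = compose {1..q} e h"
      using injs_image_factor[OF e w] .
    \<comment> \<open>Surjectivity of \<open>g2 \<circ> h\<close> comes from the image of
      \<open>r\<close> having the whole copy of \<open>m\<close> as its support.\<close>
    have "compose {1..q} g2 h \<in> Hom surj_cat q m \<and> fmap A q m (compose {1..q} g2 h) c = a"
      using ra unfolding rw wh hat_map_transport_iff[OF A e surj_homD(1)[OF g2] h c a] .
    moreover have "compose {1..q} f2 h \<in> Hom surj_cat q n \<and> fmap A q n (compose {1..q} f2 h) c = b"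
      using rb unfolding rw wh hat_map_transport_iff[OF A e surj_homD(1)[OF f2] h c b] .
    ultimately show "\<exists>q h. \<exists>c\<in>fobj A q. h \<in> Hom fin_cat q p \<and> inj_on h {1..q} \<and>
        Cmp fin_cat q f2 h \<in> Hom surj_cat q n \<and> Cmp fin_cat q g2 h \<in> Hom surj_cat q m \<and>
        fmap A q m (Cmp fin_cat q g2 h) c = a \<and> fmap A q n (Cmp fin_cat q f2 h) c = b"
      using h c by (intro exI[of _ q] exI[of _ h] bexI[of _ c]) (simp_all add: fin_cat_def)
  qed
qed

end
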